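(* Let $0<R<1$, $0<\mu\le 1-R$ with $(1-R)/\mu$ an integer, and $0\le\ell\le1$. Then the asymptotic growth rate of the redundant random ensembles satisfies $$\sigma_\ell(R,\mu)\ \ge\ \begin{cases}H(\ell)-(1-R), & \ell\le\mu,\\ H(\ell), & \ell>\mu.\end{cases}$$
   Context: $H(x)=-x\log_2x-(1-x)\log_2(1-x)$ is the binary entropy function (with $0\log_2 0=0$). For $h,x\in\{0,1\}^n$ let $h\circ x=\sum_i h_ix_i$, computed in the integers. For a binary matrix $M$ with $n$ columns, $x\in\{0,1\}^n$ is a stopping set (SS) vector of $M$ if no row $h$ of $M$ satisfies $h\circ x=1$. $S_w(M)$ is the number of SS vectors of $M$ of Hamming weight $w$. Redundant extension: for a binary $m\times n$ matrix $H$ ($1\le m<n$) and a positive divisor $L$ of $m$, partition the rows into $m/L$ consecutive blocks of $L$ rows; $H^{(L)}$ is the $(2^L-1)(m/L)\times n$ matrix whose rows are, for each block, all $2^L-1$ linear combinations over $F_2$ of its $L$ rows with nonzero coefficient vector. $\mathcal R_{m,n}$ is the set of all $2^{mn}$ binary $m\times n$ matrices, and the redundant random ensemble $\mathcal R_{m,n}^{(L)}$ is the family $\{H^{(L)}:H\in\mathcal R_{m,n}\}$ with the uniform probability $2^{-mn}$ on the index $H$; its average SS weight distribution is $S_w^{\mathcal R_{m,n}^{(L)}}=2^{-mn}\sum_{H\in\mathcal R_{m,n}}S_w(H^{(L)})$. The asymptotic growth rate is $$\sigma_\ell(R,\mu)=\lim_{n\to\infty}\frac1n\log_2 S_{\ell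 n}^{\mathcal R_{(1-R)n,n}^{(\mu n)}}.$$ Here $R,\mu,\ell$ are rational, the limit is over those $n$ for which $(1-R)n$, $\mu n$ and $\ell n$ are integers, and the limit is assumed to exist. *)

theory Defs
  imports
    Complex_Main
    "HOL-Library.Z2"
    "Jordan_Normal_Form.Matrix"
begin

text \<open>
  Binary vectors and matrices are vectors and matrices over the two-element field
  \<^typ>\<open>bit\<close>; row, column and coordinate indices start at 0.
\<close>

text \<open>The summands at \<open>x = 0\<close> and \<open>x = 1\<close> carry a factor 0, so \<open>0 log 0 = 0\<close> holds.\<close>

definition binary_entropy :: "real \<Rightarrow> real" where
  "binary_entropy x = - x * log 2 x - (1 - x) * log 2 (1 - x)"

definition int_of_bit :: "bit \<Rightarrow> int" where
  "int_of_bit b = (if b = 1 then 1 else 0)"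

text \<open>The product \<open>h \<circ> x\<close> is computed in the integers, not in the two-element field.\<close>

definition int_prod :: "bit vec \<Rightarrow> bit vec \<Rightarrow> int" where
  "int_prod h x = (\<Sum>i<dim_vec x. int_of_bit (h $ i) * int_of_bit (x $ i))"

definition hamming_weight :: "bit vec \<Rightarrow> nat" where
  "hamming_weight x = card {i. i < dim_vec x \<and> x $ i = 1}"

definition is_ss_vec :: "bit mat \<Rightarrow> bit vec \<Rightarrow> bool" where
  "is_ss_vec M x \<longleftrightarrow>
     x \<in> carrier_vec (dim_col M) \<and> \<not> (\<exists>i<dim_row M. int_prod (row M i) x = 1)"

definition ss_count :: "nat \<Rightarrow> bit mat \<Rightarrow> nat" where
  "ss_count w M = card {x. is_ss_vec M x \<and> hamming_weight x = w}"

text \<open>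
  The rows of the redundant extension are enumerated block by block. Row \<open>i\<close> belongs to block
  \<open>i div (2 ^ L - 1)\<close>, which consists of the rows \<open>L * b, \<dots>, L * b + L - 1\<close> of \<open>H\<close> for that
  block index \<open>b\<close>. Its coefficient vector is the binary expansion of
  \<open>i mod (2 ^ L - 1) + 1\<close>; this number runs through \<open>1, \<dots>, 2 ^ L - 1\<close>, so each nonzero
  coefficient vector of length \<open>L\<close> occurs exactly once per block.
\<close>

definition redundant_extension :: "nat \<Rightarrow> bit mat \<Rightarrow> bit mat" where
  "redundant_extension L H =
     mat ((2 ^ L - 1) * (dim_row H div L)) (dim_col H)
       (\<lambda>(i, j). \<Sum>k<L. of_bool (bit (i mod (2 ^ L - 1) + 1) k)
                        * H $$ (L * (i div (2 ^ L - 1)) + k, j))"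

definition avg_ss_redundant :: "nat \<Rightarrow> nat \<Rightarrow> nat \<Rightarrow> nat \<Rightarrow> real" where
  "avg_ss_redundant L m n w =
     (\<Sum>H\<in>carrier_mat m n. real (ss_count w (redundant_extension L H))) / 2 ^ (m * n)"

definition admissible_lengths :: "real \<Rightarrow> real \<Rightarrow> real \<Rightarrow> nat set" where
  "admissible_lengths R \<mu> l =
     {n. (1 - R) * real n \<in> \<int> \<and> \<mu> * real n \<in> \<int> \<and> l * real n \<in> \<int>}"

text \<open>The floors below are exact at the admissible lengths, the only ones the limit sees.\<close>

definition growth_seq :: "real \<Rightarrow> real \<Rightarrow> real \<Rightarrow> nat \<Rightarrow> real" where
  "growth_seq R \<mu> l n =
     1 / real n * log 2 (avg_ss_redundant (nat \<lfloor>\<mu> * real n\<rfloor>) (nat \<lfloor>(1 - R) * real n\<rfloor>) n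
                           (nat \<lfloor>l * real n\<rfloor>))"

definition growth_filter :: "real \<Rightarrow> real \<Rightarrow> real \<Rightarrow> nat filter" where
  "growth_filter R \<mu> l = inf sequentially (principal (admissible_lengths R \<mu> l))"

text \<open>
  At admissible \<open>n > 0\<close> the average lies between \<open>2 ^ -m\<close> and \<open>2 ^ n\<close>, where
  \<open>m = (1 - R) * n\<close>: every codeword of \<open>H\<close> is a stopping set vector of its extension, and a
  fixed vector is a codeword of at least a fraction \<open>2 ^ -m\<close> of all \<open>H\<close>. So the logarithm
  never sees 0, and a limit can only be a real number.
\<close>

definition growth_rate :: "real \<Rightarrow> real \<Rightarrow> real \<Rightarrow> real" where
  "growth_rate R \<mu> l = Lim (growth_filter R \<mu> l) (growth_seq R \<mu> l)"

end

(* The average is a sum over the words x of weight w = l n of the fraction of matrices H for which x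
   is a stopping set vector of the extension, and log2 (n choose w) / n tends to H(l). Every
   codeword is a stopping set vector, since its integer products with the rows are even, and x is a
   codeword for at least a fraction 2^-m of all H, losing at most 1 - R in the exponent. If l > mu, the
   union bound does better: each of the fewer than 2^L m rows of the extension meets x exactly once
   with probability w 2^-w, and w m 2^(L - w) tends to 0, so almost every H has x as a stopping set
   vector and nothing is lost. *)

theory Submission
  imports Defs "HOL-Real_Asymp.Real_Asymp"
begin

section \<open>Entropy lower bound for binomial coefficients\<close>

text \<open>The sequence \<open>w ^ k / fact k\<close> peaks at \<open>k = w\<close>: the ratio of
  consecutive terms is \<open>w / (k + 1)\<close>, which is at least 1 exactly for
  \<open>k < w\<close>. Denominators are cleared to stay in the naturals.\<close>

lemma fact_power_le: "fact w * w ^ k \<le> fact k * (w::nat) ^ w"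
proof (cases "k \<le> w")
  case True
  have "fact w \<le> fact k * w ^ (w - k)"
    using True
  proof (induction w rule: dec_induct)
    case (step v)
    have "fact (Suc v) = Suc v * fact v"
      by simp
    also have "\<dots> \<le> Suc v * (fact k * v ^ (v - k))"
      using step by (intro mult_le_mono) auto
    also have "\<dots> \<le> Suc v * (fact k * Suc v ^ (v - k))"
      by (intro mult_le_mono power_mono) auto
    also have "\<dots> = fact k * Suc v ^ (Suc v - k)"
      using step by (simp add: Suc_diff_le algebra_simps)
    finally show ?case .
  qed simp
  hence "fact w * w ^ k \<le> fact k * w ^ (w - k) * w ^ k"
    by simp
  also have "\<dots> = fact k * w ^ w"
    using True by (simp flip: power_add)
  finally show ?thesis .
next
  case False
  hence "w \<le> k" by simp
  hence "fact w * w ^ (k - w) \<le> fact k"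
  proof (induction k rule: dec_induct)
    case (step v)
    have "fact w * w ^ (Suc v - w) = w * (fact w * w ^ (v - w))"
      using step by (simp add: Suc_diff_le algebra_simps)
    also have "\<dots> \<le> Suc v * fact v"
      using step by (intro mult_le_mono) auto
    finally show ?case by simp
  qed simp
  hence "fact w * w ^ (k - w) * w ^ w \<le> fact k * w ^ w"
    by simp
  moreover have "w ^ k = w ^ (k - w) * w ^ w"
    using False by (simp flip: power_add)
  ultimately show ?thesis
    by (simp add: mult.assoc)
qed

text \<open>In the binomial expansion of \<open>(w + (n - w)) ^ n\<close> each of the
  \<open>n + 1\<close> terms is at most the one at \<open>k = w\<close>.\<close>

lemma power_le_binomial_mult:
  fixes n w :: nat
  assumes "w \<le> n"
  shows "n ^ n \<le> (n + 1) * (n choose w) * w ^ w * (n - w) ^ (n - w)"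
proof -
  have term_le: "(n choose k) * w ^ k * (n - w) ^ (n - k)
      \<le> (n choose w) * w ^ w * (n - w) ^ (n - w)" (is "?a \<le> ?b") if "k \<le> n" for k
  proof -
    \<comment> \<open>Multiplying by \<open>?D\<close> clears the denominators of both binomial
      coefficients. What remains is a product of two instances of \<open>fact_power_le\<close>, one
      for \<open>w\<close> and one for \<open>n - w\<close>.\<close>
    let ?D = "fact w * fact (n - w) * (fact k * fact (n - k)) :: nat"
    have "?D * ?a = (fact k * fact (n - k) * (n choose k))
        * ((fact w * w ^ k) * (fact (n - w) * (n - w) ^ (n - k)))"
      by (simp add: ac_simps)
    also have "\<dots> = fact n * ((fact w * w ^ k) * (fact (n - w) * (n - w) ^ (n - k)))"
      using that by (simp only: binomial_fact_lemma)
    also have "\<dots> \<le> fact n * ((fact k * w ^ w) * (fact (n - k) * (n - w) ^ (n - w)))"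
      by (intro mult_le_mono fact_power_le order_refl)
    also have "\<dots> = (fact w * fact (n - w) * (n choose w))
        * ((fact k * w ^ w) * (fact (n - k) * (n - w) ^ (n - w)))"
      using assms by (simp only: binomial_fact_lemma)
    also have "\<dots> = ?D * ?b"
      by (simp add: ac_simps)
    finally show ?thesis
      by simp
  qed
  have "n ^ n = (\<Sum>k\<le>n. (n choose k) * w ^ k * (n - w) ^ (n - k))"
    using binomial[of w "n - w" n] assms by simp
  also have "\<dots> \<le> (\<Sum>k\<le>n. (n choose w) * w ^ w * (n - w) ^ (n - w))"
    using term_le by (intro sum_mono) auto
  finally show ?thesis
    by (simp add: algebra_simps)
qed

lemma log_self_power: "log 2 (real w ^ w) = real w * log 2 (real w)"
  by (cases "w = 0") (auto simp: log_nat_power)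

text \<open>This is the logarithm of \<open>power_le_binomial_mult\<close>, since
  \<open>n H(w/n) = n log n - w log w - (n - w) log (n - w)\<close>. The factor \<open>n + 1\<close>
  costs only \<open>log 2 (n + 1) / n\<close>, which vanishes in the limit.\<close>

lemma entropy_le_log_binomial:
  fixes n w :: nat
  assumes "w \<le> n" "0 < n"
  shows "binary_entropy (real w / real n)
    \<le> (log 2 (real (n choose w)) + log 2 (real n + 1)) / real n"
proof -
  \<comment> \<open>The endpoints \<open>w = 0\<close> and \<open>w = n\<close> are covered because
    \<open>0 ^ 0 = 1\<close>.\<close>
  have self_power_pos: "0 < real v ^ v" for v :: nat
    by (cases "v = 0") auto
  have binomial_pos: "0 < real (n choose w)"
    using assms by simp
  have "real (n ^ n) \<le> real ((n + 1) * (n choose w) * w ^ w * (n - w) ^ (n - w))"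
    using power_le_binomial_mult[OF assms(1)] by (rule of_nat_mono)
  hence "real n ^ n \<le> (real n + 1) * real (n choose w) * real w ^ w * real (n - w) ^ (n - w)"
    by (simp add: algebra_simps)
  hence "log 2 (real n ^ n)
      \<le> log 2 ((real n + 1) * real (n choose w) * real w ^ w * real (n - w) ^ (n - w))"
    using assms self_power_pos[of n] by (intro log_mono) auto
  also have "\<dots> = log 2 (real n + 1) + log 2 (real (n choose w)) + real w * log 2 (real w)
      + real (n - w) * log 2 (real (n - w))"
    using self_power_pos[of w] self_power_pos[of "n - w"] binomial_pos
    by (simp add: log_mult_pos log_self_power del: of_nat_diff)
  finally have main: "real n * log 2 (real n) \<le> log 2 (real n + 1) + log 2 (real (n choose w))
      + real w * log 2 (real w) + real (n - w) * log 2 (real (n - w))"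
    by (simp add: log_self_power)
  have log_quotient: "real v * log 2 (real v / real n) = real v * log 2 (real v) - real v * log 2 (real n)"
    for v :: nat
    using assms by (cases "v = 0") (auto simp: log_divide_pos algebra_simps)
  have "1 - real w / real n = real (n - w) / real n"
    using assms by (simp add: field_simps of_nat_diff)
  hence "binary_entropy (real w / real n) = - (real w / real n) * log 2 (real w / real n)
      - real (n - w) / real n * log 2 (real (n - w) / real n)"
    by (simp only: binary_entropy_def)
  hence "real n * binary_entropy (real w / real n)
      = - (real w * log 2 (real w / real n)) - real (n - w) * log 2 (real (n - w) / real n)"
    using assms by (simp add: right_diff_distrib del: of_nat_diff)
  also have "\<dots> = real n * log 2 (real n) - real w * log 2 (real w)
      - real (n - w) * log 2 (real (n - w))"
    unfolding log_quotient using assms by (simp add: of_nat_diff algebra_simps)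
  also have "\<dots> \<le> log 2 (real (n choose w)) + log 2 (real n + 1)"
    using main by simp
  finally show ?thesis
    using assms by (simp add: field_simps)
qed

section \<open>Counting binary matrices and vectors\<close>

lemma bij_betw_bit_mat:
  "bij_betw (\<lambda>f. mat m n f) (({..<m} \<times> {..<n}) \<rightarrow>\<^sub>E UNIV) (carrier_mat m n)"
  by (rule bij_betwI[where g = "\<lambda>H. restrict (\<lambda>p. H $$ p) ({..<m} \<times> {..<n})"])
     (auto simp: PiE_def extensional_def restrict_def fun_eq_iff)

lemma card_UNIV_bit: "card (UNIV :: bit set) = 2"
proof -
  have "(UNIV :: bit set) = {0, 1}"
    using bit.exhaust by blast
  thus ?thesis by (metis card_2_iff zero_neq_one)
qed

lemma finite_bit_mat: "finite (carrier_mat m n :: bit mat set)"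
  and card_bit_mat: "card (carrier_mat m n :: bit mat set) = 2 ^ (m * n)"
proof -
  have fin: "finite (UNIV :: bit set)"
    using card_UNIV_bit card_ge_0_finite by force
  show "finite (carrier_mat m n :: bit mat set)"
    using bij_betw_finite[OF bij_betw_bit_mat[where 'a = bit]] fin by (simp add: finite_PiE)
  show "card (carrier_mat m n :: bit mat set) = 2 ^ (m * n)"
    using bij_betw_same_card[OF bij_betw_bit_mat[where 'a = bit, of m n]] card_UNIV_bit
    by (simp add: card_PiE card_cartesian_product)
qed

lemma bij_betw_indicator_vec:
  "bij_betw (\<lambda>S. vec n (\<lambda>i. of_bool (i \<in> S)) :: bit vec) (Pow {..<n}) (carrier_vec n)"
  by (rule bij_betwI[where g = "\<lambda>x. {i. i < n \<and> x $ i = 1}"]) auto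

lemma finite_bit_vec: "finite (carrier_vec n :: bit vec set)"
  and card_bit_vec: "card (carrier_vec n :: bit vec set) = 2 ^ n"
  using bij_betw_finite[OF bij_betw_indicator_vec[of n]]
    bij_betw_same_card[OF bij_betw_indicator_vec[of n]]
  by (auto simp: card_Pow)

lemma card_hamming_sphere:
  "card {x \<in> carrier_vec n. hamming_weight x = w} = n choose w"
proof -
  have "bij_betw (\<lambda>S. vec n (\<lambda>i. of_bool (i \<in> S)) :: bit vec)
      {S. S \<subseteq> {..<n} \<and> card S = w} {x \<in> carrier_vec n. hamming_weight x = w}"
  proof (rule bij_betwI[where g = "\<lambda>x. {i. i < n \<and> x $ i = 1}"])
    have "{i. i < n \<and> (vec n (\<lambda>i. of_bool (i \<in> S)) :: bit vec) $ i = 1} = S" if "S \<subseteq> {..<n}" for S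
      using that by auto
    thus "(\<lambda>S. vec n (\<lambda>i. of_bool (i \<in> S)) :: bit vec) \<in> {S. S \<subseteq> {..<n} \<and> card S = w} \<rightarrow>
        {x \<in> carrier_vec n. hamming_weight x = w}"
      by (auto simp: hamming_weight_def)
  qed (auto simp: hamming_weight_def)
  thus ?thesis
    using n_subsets[of "{..<n}" w] by (simp add: bij_betw_same_card[symmetric])
qed

section \<open>From single vectors to the ensemble average\<close>

text \<open>Double counting of pairs (matrix, stopping set vector) reduces a bound on the average to
  a bound, uniform in \<open>x\<close>, on the fraction of good matrices for a fixed
  \<open>x\<close>. The constant \<open>c\<close> may be negative, as happens in the union bound for
  short lengths.\<close>

lemma card_ss_fraction_le_avg:
  assumes "\<And>x. \<lbrakk>x \<in> carrier_vec n; hamming_weight x = w\<rbrakk> \<Longrightarrow>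
      c * 2 ^ (m * n) \<le> real (card {H \<in> carrier_mat m n. is_ss_vec (redundant_extension L H) x})"
  shows "c * real (n choose w) \<le> avg_ss_redundant L m n w"
proof -
  let ?X = "{x \<in> carrier_vec n. hamming_weight x = w}" and ?M = "carrier_mat m n :: bit mat set"
  let ?P = "\<lambda>H x. is_ss_vec (redundant_extension L H) x"
  have finX: "finite ?X"
    using finite_bit_vec by simp
  have "{x. ?P H x \<and> hamming_weight x = w} = {x \<in> ?X. ?P H x}" if "H \<in> ?M" for H
    using that by (auto simp: is_ss_vec_def redundant_extension_def)
  hence "(\<Sum>H\<in>?M. real (ss_count w (redundant_extension L H)))
      = (\<Sum>H\<in>?M. \<Sum>x\<in>?X. of_bool (?P H x))"
    using finX by (intro sum.cong) (auto simp: ss_count_def of_bool_def sum.If_cases Int_def)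
  also have "\<dots> = (\<Sum>x\<in>?X. real (card {H \<in> ?M. ?P H x}))"
    by (subst sum.swap)
       (auto intro!: sum.cong simp: of_bool_def sum.If_cases finite_bit_mat Int_def)
  also have "\<dots> \<ge> (\<Sum>x\<in>?X. c * 2 ^ (m * n))"
    using assms by (intro sum_mono) auto
  finally have "real (n choose w) * (c * 2 ^ (m * n))
      \<le> (\<Sum>H\<in>?M. real (ss_count w (redundant_extension L H)))"
    by (simp add: card_hamming_sphere)
  thus ?thesis
    by (simp add: avg_ss_redundant_def field_simps)
qed

section \<open>Rows of the extension and the codeword bound\<close>

text \<open>Ensures that row \<open>i\<close> of the extension reads only entries inside
  \<open>H\<close>; values outside the index range are unspecified.\<close>

lemma redundant_extension_row_bound:
  assumes "i < (2 ^ L - 1) * (m div L)" "k < L"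
  shows "L * (i div (2 ^ L - 1)) + k < m"
proof -
  have "i div (2 ^ L - 1) < m div L"
    using assms(1) by (simp add: less_mult_imp_div_less mult.commute)
  have "L * (i div (2 ^ L - 1)) + k < L * (i div (2 ^ L - 1) + 1)"
    using assms(2) by simp
  also have "\<dots> \<le> L * (m div L)"
    using \<open>i div (2 ^ L - 1) < m div L\<close> by (intro mult_le_mono) auto
  also have "\<dots> \<le> m"
    by simp
  finally show ?thesis .
qed

lemma redundant_extension_entry:
  assumes "i < (2 ^ L - 1) * (m div L)" "H \<in> carrier_mat m n" "j < n"
  shows "redundant_extension L H $$ (i, j)
    = (\<Sum>k<L. of_bool (bit (i mod (2 ^ L - 1) + 1) k) * H $$ (L * (i div (2 ^ L - 1)) + k, j))"
  using assms by (simp add: redundant_extension_def)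

lemma of_int_of_bit: "(of_int (int_of_bit b) :: bit) = b"
  by (cases b) (auto simp: int_of_bit_def)

text \<open>Rows of the extension are combinations over the two-element field of rows orthogonal to
  \<open>x\<close>, so their integer products with \<open>x\<close> are even.\<close>

lemma is_ss_vec_codeword:
  assumes H: "H \<in> carrier_mat m n" and x: "x \<in> carrier_vec n"
    and codeword: "H *\<^sub>v x = 0\<^sub>v m"
  shows "is_ss_vec (redundant_extension L H) x"
  unfolding is_ss_vec_def
proof (intro conjI notI)
  let ?E = "redundant_extension L H"
  show "x \<in> carrier_vec (dim_col ?E)"
    using assms by (simp add: redundant_extension_def)
  assume "\<exists>i<dim_row ?E. int_prod (row ?E i) x = 1"
  then obtain i where i: "i < (2 ^ L - 1) * (m div L)" and one: "int_prod (row ?E i) x = 1"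
    using H by (auto simp: redundant_extension_def)
  define b where "b = i div (2 ^ L - 1)"
  have b: "L * b + k < m" if "k < L" for k
    unfolding b_def using i that by (rule redundant_extension_row_bound)
  have entry: "redundant_extension L H $$ (i, j)
      = (\<Sum>k<L. of_bool (bit (i mod (2 ^ L - 1) + 1) k) * H $$ (L * b + k, j))"
    if "H \<in> carrier_mat m n" "j < n" for H j
    unfolding b_def using i that by (rule redundant_extension_entry)
  have row0: "(\<Sum>j<n. H $$ (r, j) * x $ j) = 0" if "r < m" for r
  proof -
    have "(H *\<^sub>v x) $ r = 0"
      using that codeword by simp
    thus ?thesis
      using that H x by (simp add: scalar_prod_def atLeast0LessThan)
  qed
  \<comment> \<open>Reduction modulo 2 turns the integer product into the product over the
    two-element field, where the value 1 is contradicted by orthogonality.\<close>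
  have "(1 :: bit) = of_int (int_prod (row ?E i) x)"
    using one by simp
  also have "\<dots> = (\<Sum>j<n. ?E $$ (i, j) * x $ j)"
    using i H x by (auto intro!: sum.cong simp: int_prod_def of_int_of_bit redundant_extension_def)
  also have "\<dots> = (\<Sum>j<n. \<Sum>k<L. of_bool (bit (i mod (2 ^ L - 1) + 1) k)
      * (H $$ (L * b + k, j) * x $ j))"
  proof (rule sum.cong)
    fix j assume "j \<in> {..<n}"
    thus "?E $$ (i, j) * x $ j = (\<Sum>k<L. of_bool (bit (i mod (2 ^ L - 1) + 1) k)
        * (H $$ (L * b + k, j) * x $ j))"
      using H by (simp only: entry lessThan_iff sum_distrib_right mult.assoc)
  qed simp
  also have "\<dots> = (\<Sum>k<L. of_bool (bit (i mod (2 ^ L - 1) + 1) k)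
      * (\<Sum>j<n. H $$ (L * b + k, j) * x $ j))"
    by (subst sum.swap) (simp only: sum_distrib_left)
  also have "\<dots> = 0"
    using b row0 by simp
  finally show False
    by simp
qed

text \<open>The additive map taking \<open>H\<close> to \<open>H *\<^sub>v x\<close> has at most
  \<open>2 ^ m\<close> values, and each nonempty fiber is a translate of the kernel.\<close>

lemma card_annihilators_ge:
  fixes x :: "bit vec"
  assumes x: "x \<in> carrier_vec n"
  shows "2 ^ (m * n) \<le> 2 ^ m * card {H \<in> carrier_mat m n. H *\<^sub>v x = 0\<^sub>v m}"
proof -
  let ?M = "carrier_mat m n :: bit mat set" and ?K = "{H \<in> carrier_mat m n. H *\<^sub>v x = 0\<^sub>v m}"
  let ?F = "\<lambda>y. {H \<in> ?M. H *\<^sub>v x = y}"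
  have fiber: "card (?F y) \<le> card ?K" for y
  proof (cases "?F y = {}")
    case False
    then obtain H0 where H0: "H0 \<in> ?M" "H0 *\<^sub>v x = y"
      by blast
    have "inj_on (\<lambda>H. H - H0) (?F y)"
    proof (rule inj_onI)
      fix H H' assume "H \<in> ?F y" "H' \<in> ?F y" "H - H0 = H' - H0"
      \<comment> \<open>Matrices of all dimensions share one type, so cancellation is checked
        entrywise within the carrier.\<close>
      moreover have "G - H0 + H0 = G" if "G \<in> ?M" for G
        using that H0 by (intro eq_matI) auto
      ultimately show "H = H'"
        by (metis (no_types, lifting) mem_Collect_eq)
    qed
    moreover have "(\<lambda>H. H - H0) ` ?F y \<subseteq> ?K"
      using H0 x by (auto simp: minus_mult_distrib_mat_vec)
    ultimately show ?thesis
      using finite_bit_mat by (intro card_inj_on_le) auto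
  qed (simp only: card.empty)
  have "?M = (\<Union>y\<in>carrier_vec m. ?F y)"
    using x by (auto intro: mult_mat_vec_carrier)
  hence "2 ^ (m * n) = card (\<Union>y\<in>carrier_vec m. ?F y)"
    by (simp flip: card_bit_mat)
  also have "\<dots> \<le> (\<Sum>y\<in>carrier_vec m. card (?F y))"
    using finite_bit_vec by (rule card_UN_le)
  also have "\<dots> \<le> (\<Sum>y\<in>(carrier_vec m :: bit vec set). card ?K)"
    by (intro sum_mono fiber)
  also have "\<dots> = 2 ^ m * card ?K"
    by (simp add: card_bit_vec)
  finally show ?thesis .
qed

lemma binomial_le_avg_codewords:
  "real (n choose w) / 2 ^ m \<le> avg_ss_redundant L m n w"
proof -
  have "1 / 2 ^ m * real (n choose w) \<le> avg_ss_redundant L m n w"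
  proof (rule card_ss_fraction_le_avg)
    fix x :: "bit vec" assume x: "x \<in> carrier_vec n"
    have "card {H \<in> carrier_mat m n. H *\<^sub>v x = 0\<^sub>v m}
        \<le> card {H \<in> carrier_mat m n. is_ss_vec (redundant_extension L H) x}"
      using is_ss_vec_codeword[OF _ x] finite_bit_mat by (intro card_mono) auto
    hence "2 ^ (m * n) \<le> 2 ^ m * card {H \<in> carrier_mat m n. is_ss_vec (redundant_extension L H) x}"
      using card_annihilators_ge[OF x, of m] by (meson le_trans mult_le_mono2)
    hence "real (2 ^ (m * n))
        \<le> real (2 ^ m * card {H \<in> carrier_mat m n. is_ss_vec (redundant_extension L H) x})"
      by (rule of_nat_mono)
    thus "1 / 2 ^ m * 2 ^ (m * n)
        \<le> real (card {H \<in> carrier_mat m n. is_ss_vec (redundant_extension L H) x})"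
      by (simp add: field_simps)
  qed
  thus ?thesis by simp
qed

section \<open>Union bound over the rows of the extension\<close>

text \<open>
  Adding a vector \<open>T\<close> to a row of \<open>H\<close> that occurs in the combination \<open>i\<close> adds \<open>T\<close> to the
  combination. If \<open>T\<close> is supported on the \<open>w\<close> coordinates of \<open>x\<close> and the combination is the unit
  vector at \<open>u\<close> on these coordinates, then \<open>T\<close>, and hence \<open>H\<close>, is determined by \<open>u\<close> and the
  modified matrix.
\<close>

lemma card_row_violation_le:
  assumes x: "x \<in> carrier_vec n" and i: "i < (2 ^ L - 1) * (m div L)"
  defines "w \<equiv> hamming_weight x"
  shows "card {H \<in> carrier_mat m n. int_prod (row (redundant_extension L H) i) x = 1} * 2 ^ w
    \<le> w * 2 ^ (m * n)"
proof -
  let ?S = "{j. j < n \<and> x $ j = 1}"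
  let ?A = "{H \<in> carrier_mat m n. int_prod (row (redundant_extension L H) i) x = 1}"
  have w: "w = card ?S"
    using x by (auto simp: w_def hamming_weight_def)
  define b where "b = i div (2 ^ L - 1)"
  have b: "L * b + k < m" if "k < L" for k
    unfolding b_def using i that by (rule redundant_extension_row_bound)
  have entry: "redundant_extension L H $$ (i, j)
      = (\<Sum>k<L. of_bool (bit (i mod (2 ^ L - 1) + 1) k) * H $$ (L * b + k, j))"
    if "H \<in> carrier_mat m n" "j < n" for H j
    unfolding b_def using i that by (rule redundant_extension_entry)
  \<comment> \<open>The number \<open>i mod (2 ^ L - 1) + 1\<close> lies between 1 and
    \<open>2 ^ L - 1\<close>: being nonzero it has a set bit, and being below \<open>2 ^ L\<close>
    it has none from position \<open>L\<close> on.\<close>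
  obtain k where k: "k < L" "bit (i mod (2 ^ L - 1) + 1) k"
  proof -
    have "0 < (2 :: nat) ^ L - 1"
      using i by (metis gr0I mult_0 not_less0)
    hence "i mod (2 ^ L - 1) < 2 ^ L - 1"
      by (rule mod_less_divisor)
    hence lt: "i mod (2 ^ L - 1) + 1 < 2 ^ L"
      by linarith
    have "\<exists>k. bit c k" if "c \<noteq> 0" for c :: nat
    proof (rule ccontr)
      assume "\<nexists>k. bit c k"
      hence "c = 0"
        by (intro bit_eqI) simp
      thus False
        using that by contradiction
    qed
    then obtain k where bit: "bit (i mod (2 ^ L - 1) + 1) k"
      by (metis add_is_0 one_neq_zero)
    hence "bit (take_bit L (i mod (2 ^ L - 1) + 1)) k"
      by (simp only: take_bit_nat_eq_self[OF lt])
    hence "k < L"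
      by (simp only: bit_take_bit_iff)
    thus thesis
      using bit by (rule that)
  qed
  define flip :: "bit mat \<Rightarrow> nat set \<Rightarrow> bit mat" where
    "flip H T = mat m n (\<lambda>(r, j). H $$ (r, j) + of_bool (r = L * b + k \<and> j \<in> T))" for H T
  have flip_entry: "redundant_extension L (flip H T) $$ (i, j)
      = redundant_extension L H $$ (i, j) + of_bool (j \<in> T)"
    if H: "H \<in> carrier_mat m n" and j: "j < n" for H T j
  proof -
    let ?c = "\<lambda>k'. of_bool (bit (i mod (2 ^ L - 1) + 1) k') :: bit"
    have "redundant_extension L (flip H T) $$ (i, j)
        = (\<Sum>k'<L. ?c k' * (H $$ (L * b + k', j) + of_bool (k' = k \<and> j \<in> T)))"
      using j b by (subst entry) (auto simp: flip_def intro!: sum.cong)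
    also have "\<dots> = redundant_extension L H $$ (i, j) + (\<Sum>k'<L. ?c k' * of_bool (k' = k \<and> j \<in> T))"
      by (simp only: entry[OF H j] distrib_left sum.distrib)
    also have "(\<Sum>k'<L. ?c k' * of_bool (k' = k \<and> j \<in> T))
        = (\<Sum>k'<L. if k' = k then of_bool (j \<in> T) else 0)"
      using k(2) by (intro sum.cong) auto
    also have "\<dots> = of_bool (j \<in> T)"
      using k(1) by simp
    finally show ?thesis .
  qed
  \<comment> \<open>The integer product counts the coordinates where the combination and
    \<open>x\<close> are both 1, so the value 1 singles out one coordinate \<open>u\<close>.\<close>
  have "\<forall>H\<in>?A. \<exists>u. u \<in> ?S \<and> (\<forall>j\<in>?S. redundant_extension L H $$ (i, j) = of_bool (j = u))"
  proof
    fix H assume "H \<in> ?A"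
    let ?r = "\<lambda>j. redundant_extension L H $$ (i, j)"
    have "int_prod (row (redundant_extension L H) i) x
        = (\<Sum>j<n. if ?r j = 1 \<and> x $ j = 1 then 1 else 0)"
      using \<open>H \<in> ?A\<close> x i unfolding int_prod_def
      by (intro sum.cong) (auto simp: int_of_bit_def redundant_extension_def)
    also have "\<dots> = int (card {j. j < n \<and> ?r j = 1 \<and> x $ j = 1})"
      by (simp add: sum.If_cases Int_def)
    finally have "card {j. j < n \<and> ?r j = 1 \<and> x $ j = 1} = 1"
      using \<open>H \<in> ?A\<close> by simp
    then obtain u where u: "{j. j < n \<and> ?r j = 1 \<and> x $ j = 1} = {u}"
      by (rule card_1_singletonE)
    have "?r j = of_bool (j = u)" if "j \<in> ?S" for j
    proof -
      have "?r j = 1 \<longleftrightarrow> j = u"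
        using u that by blast
      thus ?thesis
        by (cases "?r j = 1") simp_all
    qed
    moreover have "u \<in> ?S"
      using u by blast
    ultimately show "\<exists>u. u \<in> ?S \<and> (\<forall>j\<in>?S. ?r j = of_bool (j = u))"
      by blast
  qed
  from bchoice[OF this] obtain u where u: "\<And>H. H \<in> ?A \<Longrightarrow> u H \<in> ?S"
    "\<And>H j. \<lbrakk>H \<in> ?A; j \<in> ?S\<rbrakk> \<Longrightarrow> redundant_extension L H $$ (i, j) = of_bool (j = u H)"
    by blast
  \<comment> \<open>There are \<open>2 ^ w\<close> choices of \<open>T\<close> and \<open>w\<close>
    choices of \<open>u\<close>, so injectivity bounds the fraction of violating matrices by
    \<open>w / 2 ^ w\<close>.\<close>
  have "inj_on (\<lambda>(H, T). (u H, flip H T)) (?A \<times> Pow ?S)"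
  proof (rule inj_onI, clarsimp)
    fix H H' T T'
    assume H: "H \<in> carrier_mat m n" "int_prod (row (redundant_extension L H) i) x = 1"
      and H': "H' \<in> carrier_mat m n" "int_prod (row (redundant_extension L H') i) x = 1"
      and T: "T \<subseteq> ?S" and T': "T' \<subseteq> ?S" and eq: "u H = u H'" "flip H T = flip H' T'"
    \<comment> \<open>On the support of \<open>x\<close> both original combinations are the unit
      vector at the common \<open>u\<close>, so equal modified combinations force equal indicators
      of \<open>T\<close> and \<open>T'\<close>.\<close>
    have "j \<in> T \<longleftrightarrow> j \<in> T'" if "j \<in> ?S" for j
    proof -
      have "redundant_extension L H $$ (i, j) = redundant_extension L H' $$ (i, j)"
        using u(2)[OF _ that, of H] u(2)[OF _ that, of H'] H H' eq(1) by simp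
      moreover have "redundant_extension L H $$ (i, j) + of_bool (j \<in> T)
          = redundant_extension L H' $$ (i, j) + of_bool (j \<in> T')"
        using flip_entry[OF H(1), of j T] flip_entry[OF H'(1), of j T'] that eq(2)
        by (metis (no_types, lifting) mem_Collect_eq)
      ultimately have "(of_bool (j \<in> T) :: bit) = of_bool (j \<in> T')"
        by (metis add_left_cancel)
      thus ?thesis by (simp only: of_bool_eq_iff)
    qed
    hence TT': "T = T'"
      using T T' by blast
    have "H $$ (r, j) = H' $$ (r, j)" if "r < m" "j < n" for r j
    proof -
      have "H $$ (r, j) + of_bool (r = L * b + k \<and> j \<in> T)
          = H' $$ (r, j) + of_bool (r = L * b + k \<and> j \<in> T')"
        using arg_cong[OF eq(2), of "\<lambda>M. M $$ (r, j)"] that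
        by (simp only: flip_def index_mat(1) case_prod_conv)
      thus ?thesis
        by (simp only: TT' add_right_cancel)
    qed
    thus "H = H' \<and> T = T'"
      using H(1) H'(1) TT' by (auto intro!: eq_matI)
  qed
  moreover have "(\<lambda>(H, T). (u H, flip H T)) ` (?A \<times> Pow ?S) \<subseteq> ?S \<times> carrier_mat m n"
    using u(1) by (auto simp: flip_def)
  ultimately have "card (?A \<times> Pow ?S) \<le> card (?S \<times> (carrier_mat m n :: bit mat set))"
    using finite_bit_mat by (intro card_inj_on_le) auto
  thus ?thesis
    by (simp add: card_cartesian_product card_Pow card_bit_mat w)
qed

text \<open>A matrix fails for \<open>x\<close> only if some row of its extension meets
  \<open>x\<close> exactly once. Summing \<open>card_row_violation_le\<close> over the rows bounds
  the fraction of such matrices.\<close>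

lemma binomial_le_avg_union_bound:
  "(1 - real w * real m * 2 ^ L / 2 ^ w) * real (n choose w) \<le> avg_ss_redundant L m n w"
proof (rule card_ss_fraction_le_avg)
  fix x :: "bit vec" assume x: "x \<in> carrier_vec n" and w: "hamming_weight x = w"
  let ?M = "carrier_mat m n :: bit mat set" and ?N = "(2 ^ L - 1) * (m div L)"
  let ?A = "\<lambda>i. {H \<in> ?M. int_prod (row (redundant_extension L H) i) x = 1}"
  let ?G = "{H \<in> ?M. is_ss_vec (redundant_extension L H) x}"
  have "?M \<subseteq> ?G \<union> (\<Union>i<?N. ?A i)"
    using x by (auto simp: is_ss_vec_def redundant_extension_def)
  hence "card ?M \<le> card (?G \<union> (\<Union>i<?N. ?A i))"
    using finite_bit_mat by (intro card_mono) auto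
  also have "\<dots> \<le> card ?G + card (\<Union>i<?N. ?A i)"
    by (rule card_Un_le)
  also have "card (\<Union>i<?N. ?A i) \<le> (\<Sum>i<?N. card (?A i))"
    by (rule card_UN_le) simp
  finally have "2 ^ (m * n) \<le> card ?G + (\<Sum>i<?N. card (?A i))"
    by (simp add: card_bit_mat)
  hence "real (2 ^ (m * n)) \<le> real (card ?G + (\<Sum>i<?N. card (?A i)))"
    by (rule of_nat_mono)
  hence total: "2 ^ (m * n) \<le> real (card ?G) + (\<Sum>i<?N. real (card (?A i)))"
    by simp
  have "real (card (?A i)) \<le> real w * 2 ^ (m * n) / 2 ^ w" if "i < ?N" for i
  proof -
    have "real (card (?A i) * 2 ^ w) \<le> real (w * 2 ^ (m * n))"
      using card_row_violation_le[OF x that] w by (intro of_nat_mono) simp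
    thus ?thesis by (simp add: field_simps)
  qed
  hence "(\<Sum>i<?N. real (card (?A i))) \<le> (\<Sum>i<?N. real w * 2 ^ (m * n) / 2 ^ w)"
    by (intro sum_mono) simp
  also have "\<dots> = real ?N * (real w * 2 ^ (m * n) / 2 ^ w)"
    by simp
  \<comment> \<open>The crude row count suffices: the polynomial factor is later absorbed by the
    decay of \<open>2 ^ L / 2 ^ w\<close>.\<close>
  also have "\<dots> \<le> (2 ^ L * real m) * (real w * 2 ^ (m * n) / 2 ^ w)"
  proof (rule mult_right_mono)
    have "?N \<le> 2 ^ L * m"
      by (intro mult_le_mono) (auto simp: div_le_dividend)
    hence "real ?N \<le> real (2 ^ L * m)"
      by (rule of_nat_mono)
    thus "real ?N \<le> 2 ^ L * real m"
      by simp
  qed simp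
  finally show "(1 - real w * real m * 2 ^ L / 2 ^ w) * 2 ^ (m * n) \<le> real (card ?G)"
    using total by (simp add: algebra_simps)
qed

section \<open>The limit along admissible lengths\<close>

text \<open>Rationality makes every multiple of a product of denominators admissible, so admissible
  lengths are unbounded. Without this, limits along the filter would not be unique and inequalities
  would not pass to them.\<close>

lemma growth_filter_neq_bot:
  assumes "R \<in> \<rat>" "\<mu> \<in> \<rat>" "l \<in> \<rat>"
  shows "growth_filter R \<mu> l \<noteq> bot"
proof -
  have denominator: "\<exists>d>0. x * real d \<in> \<int>" if x: "x \<in> \<rat>" for x :: real
  proof -
    obtain a b :: int where "b > 0" "coprime a b" "x = of_int a / of_int b"
      using x by (rule Rats_cases')
    thus ?thesis
      by (intro exI[of _ "nat b"]) (auto simp: less_imp_le)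
  qed
  obtain d1 d2 d3 where d: "d1 > 0" "(1 - R) * real d1 \<in> \<int>"
    "d2 > 0" "\<mu> * real d2 \<in> \<int>" "d3 > 0" "l * real d3 \<in> \<int>"
    using denominator[of "1 - R"] denominator[of \<mu>] denominator[of l] assms by auto
  let ?d = "d1 * d2 * d3"
  have "?d * N \<in> admissible_lengths R \<mu> l" for N
  proof -
    have "((1 - R) * real d1) * real (d2 * d3 * N) \<in> \<int>"
      by (rule Ints_mult[OF d(2) Ints_of_nat])
    moreover have "(\<mu> * real d2) * real (d1 * d3 * N) \<in> \<int>"
      by (rule Ints_mult[OF d(4) Ints_of_nat])
    moreover have "(l * real d3) * real (d1 * d2 * N) \<in> \<int>"
      by (rule Ints_mult[OF d(6) Ints_of_nat])
    ultimately show ?thesis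
      by (simp add: admissible_lengths_def ac_simps)
  qed
  moreover have "N \<le> ?d * N" for N
    using d by simp
  ultimately have "\<exists>n\<ge>N. n \<in> admissible_lengths R \<mu> l" for N
    by blast
  thus ?thesis
    by (auto simp: growth_filter_def trivial_limit_def eventually_inf_principal
        eventually_sequentially)
qed

theorem corollary1:
  fixes R \<mu> l :: real
  assumes "R \<in> \<rat>" and "\<mu> \<in> \<rat>" and "l \<in> \<rat>"
    and "0 < R" and "R < 1"
    and "0 < \<mu>" and "\<mu> \<le> 1 - R" and "(1 - R) / \<mu> \<in> \<int>"
    and "0 \<le> l" and "l \<le> 1"
    and limit_exists: "\<exists>s. (growth_seq R \<mu> l \<longlongrightarrow> s) (growth_filter R \<mu> l)"
  shows "growth_rate R \<mu> l \<ge>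
    (if l \<le> \<mu> then binary_entropy l - (1 - R) else binary_entropy l)"
proof -
  let ?F = "growth_filter R \<mu> l"
  let ?A = "\<lambda>n. avg_ss_redundant (nat \<lfloor>\<mu> * real n\<rfloor>) (nat \<lfloor>(1 - R) * real n\<rfloor>) n (nat \<lfloor>l * real n\<rfloor>)"
  \<comment> \<open>Shared by both cases: \<open>e\<close> is the loss in bits against the full
    count of weight-\<open>w\<close> vectors. It will be \<open>m\<close> for the codeword bound and
    1 for the union bound.\<close>
  have le_seq: "binary_entropy l - log 2 (real n + 1) / real n - e / real n \<le> growth_seq R \<mu> l n"
    if n: "0 < n" "n \<in> admissible_lengths R \<mu> l"
      and avg: "2 powr (- e) * real (n choose nat \<lfloor>l * real n\<rfloor>) \<le> ?A n" for n e
  proof -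
    define w where "w = nat \<lfloor>l * real n\<rfloor>"
    \<comment> \<open>The floor is exact at admissible lengths, so \<open>w / n\<close> is
      \<open>l\<close> itself and no continuity of the entropy is involved.\<close>
    have w: "real w = l * real n"
      using n assms by (auto simp: w_def admissible_lengths_def elim!: Ints_cases)
    have "real w \<le> real n"
      unfolding w using assms by (simp add: mult_left_le_one_le)
    hence "w \<le> n" by simp
    hence pos: "0 < real (n choose w)"
      by simp
    have "log 2 (2 powr (- e) * real (n choose w)) \<le> log 2 (?A n)"
      using avg pos by (intro log_mono) (auto simp: w_def)
    hence "log 2 (real (n choose w)) - e \<le> log 2 (?A n)"
      using pos by (simp add: log_mult_pos)
    hence "(log 2 (real (n choose w)) - e) / real n \<le> growth_seq R \<mu> l n"
      by (simp add: growth_seq_def divide_right_mono)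
    moreover have "binary_entropy l
        \<le> (log 2 (real (n choose w)) + log 2 (real n + 1)) / real n"
      using entropy_le_log_binomial[OF \<open>w \<le> n\<close> n(1)] n(1) by (simp add: w)
    ultimately show ?thesis
      by (simp add: add_divide_distrib diff_divide_distrib)
  qed
  have filter_le: "?F \<le> sequentially"
    by (simp add: growth_filter_def)
  have eventually_admissible: "\<forall>\<^sub>F n in ?F. 0 < n \<and> n \<in> admissible_lengths R \<mu> l"
    unfolding growth_filter_def eventually_inf_principal
    by (intro eventually_mono[OF eventually_gt_at_top[of 0]]) auto
  obtain s where s: "(growth_seq R \<mu> l \<longlongrightarrow> s) ?F"
    using limit_exists by blast
  have nontrivial: "?F \<noteq> bot"
    using assms by (intro growth_filter_neq_bot)
  have rate: "growth_rate R \<mu> l = s"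
    unfolding growth_rate_def using nontrivial s by (rule tendsto_Lim)
  show ?thesis
  proof (cases "l \<le> \<mu>")
    case True
    have "((\<lambda>n. binary_entropy l - log 2 (real n + 1) / real n - (1 - R))
        \<longlongrightarrow> binary_entropy l - (1 - R)) sequentially"
      by real_asymp
    hence lim: "((\<lambda>n. binary_entropy l - log 2 (real n + 1) / real n - (1 - R))
        \<longlongrightarrow> binary_entropy l - (1 - R)) ?F"
      using filter_le by (rule tendsto_mono[rotated])
    have "\<forall>\<^sub>F n in ?F. binary_entropy l - log 2 (real n + 1) / real n - (1 - R)
        \<le> growth_seq R \<mu> l n"
      using eventually_admissible
    proof eventually_elim
      case (elim n)
      define m where "m = nat \<lfloor>(1 - R) * real n\<rfloor>"
      have m: "real m = (1 - R) * real n"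
        using elim assms by (auto simp: m_def admissible_lengths_def elim!: Ints_cases)
      \<comment> \<open>Here \<open>e = m\<close>, and \<open>m / n\<close> equals
        \<open>1 - R\<close> exactly.\<close>
      have "2 powr (- real m) * real (n choose nat \<lfloor>l * real n\<rfloor>) \<le> ?A n"
        using binomial_le_avg_codewords[of n "nat \<lfloor>l * real n\<rfloor>" m "nat \<lfloor>\<mu> * real n\<rfloor>"]
        by (simp add: powr_minus powr_realpow m_def field_simps)
      from le_seq[OF _ _ this] show ?case
        using elim by (simp add: m)
    qed
    hence "binary_entropy l - (1 - R) \<le> s"
      by (rule tendsto_le[OF nontrivial s lim])
    thus ?thesis
      using True by (simp add: rate)
  next
    case False
    \<comment> \<open>The gap \<open>c\<close> is the exponential decay rate of
      \<open>2 ^ L / 2 ^ w\<close>; it beats the factor \<open>n * n\<close> that bounds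
      \<open>w * m\<close>.\<close>
    define c where "c = l - \<mu>"
    have "0 < c"
      using False by (simp add: c_def)
    hence "(\<lambda>n. real n * real n * 2 powr (- c * real n)) \<longlonglongrightarrow> 0"
      by real_asymp
    moreover have "- c * real n = \<mu> * real n - l * real n" for n
      by (simp add: c_def algebra_simps)
    ultimately have "(\<lambda>n. real n * real n * 2 powr (\<mu> * real n - l * real n)) \<longlonglongrightarrow> 0"
      by simp
    hence "\<forall>\<^sub>F n in sequentially. real n * real n * 2 powr (\<mu> * real n - l * real n) < 1 / 2"
      by (rule order_tendstoD) simp
    hence small: "\<forall>\<^sub>F n in ?F. real n * real n * 2 powr (\<mu> * real n - l * real n) < 1 / 2"
      using filter_le by (rule filter_leD[rotated])
    have "((\<lambda>n. binary_entropy l - log 2 (real n + 1) / real n - 1 / real n)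
        \<longlongrightarrow> binary_entropy l) sequentially"
      by real_asymp
    hence lim: "((\<lambda>n. binary_entropy l - log 2 (real n + 1) / real n - 1 / real n)
        \<longlongrightarrow> binary_entropy l) ?F"
      using filter_le by (rule tendsto_mono[rotated])
    have "\<forall>\<^sub>F n in ?F. binary_entropy l - log 2 (real n + 1) / real n - 1 / real n
        \<le> growth_seq R \<mu> l n"
      using eventually_admissible small
    proof eventually_elim
      case (elim n)
      define m where "m = nat \<lfloor>(1 - R) * real n\<rfloor>"
      define L where "L = nat \<lfloor>\<mu> * real n\<rfloor>"
      define w where "w = nat \<lfloor>l * real n\<rfloor>"
      have m: "real m = (1 - R) * real n" and L: "real L = \<mu> * real n" and w: "real w = l * real n"
        using elim assms
        by (auto simp: m_def L_def w_def admissible_lengths_def elim!: Ints_cases)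
      have "real m \<le> real n" "real w \<le> real n"
        unfolding m w using assms by (auto intro!: mult_left_le_one_le)
      hence "real w * real m * (2 ^ L / 2 ^ w) \<le> real n * real n * (2 ^ L / 2 ^ w)"
        by (intro mult_right_mono mult_mono) auto
      moreover have "(2 :: real) ^ L / 2 ^ w = 2 powr (\<mu> * real n - l * real n)"
        by (simp add: powr_diff powr_realpow flip: L w)
      ultimately have "real w * real m * 2 ^ L / 2 ^ w
          \<le> real n * real n * 2 powr (\<mu> * real n - l * real n)"
        by (metis times_divide_eq_right)
      \<comment> \<open>Keeping half of the matrices costs one bit, hence \<open>1 / n\<close> in
        the rate, which tends to 0.\<close>
      hence "1 / 2 \<le> 1 - real w * real m * 2 ^ L / 2 ^ w"
        using elim(2) by linarith
      hence "1 / 2 * real (n choose w) \<le> (1 - real w * real m * 2 ^ L / 2 ^ w) * real (n choose w)"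
        by (intro mult_right_mono) auto
      also have "\<dots> \<le> avg_ss_redundant L m n w"
        by (rule binomial_le_avg_union_bound)
      finally have "2 powr (- 1) * real (n choose nat \<lfloor>l * real n\<rfloor>) \<le> ?A n"
        by (simp add: powr_minus m_def L_def w_def)
      from le_seq[OF _ _ this] show ?case
        using elim by simp
    qed
    hence "binary_entropy l \<le> s"
      by (rule tendsto_le[OF nontrivial s lim])
    thus ?thesis
      using False by (simp add: rate)
  qed
qed

end
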